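(* Let $d>k>1$ be integers, let $\ell:\mathbb{R}^d\to\mathbb{R}$ be a continuous coercive loss function, and let $\alpha'$ satisfy $\min(\ell)\le\alpha'<\alpha_{\max}$. Let $\Theta_{\ell_{\alpha'}}$ denote the gap parameter of the loss function $\ell_{\alpha'}:=\max(\ell,\alpha')$, and let $$\delta_{\alpha'}:=\frac{1}{\sqrt2}\,\frac{\|\phi_{\alpha'}-\overline{\phi_{\alpha'}}\|_2}{\alpha_{\max}-\alpha'},$$ where $\phi_{\alpha'}(\eta):=\min_{x\in\eta}\ell_{\alpha'}(x)=\max(\phi(\eta),\alpha')$ for $\eta\in\mathcal G_{k,d}$, $\overline{\phi_{\alpha'}}$ is its mean over $\mathcal G_{k,d}$, and $\|\cdot\|_2$ is the $L^2$-norm over $\mathcal G_{k,d}$. Let $T\ge1$ be an integer, let $x_0\in\mathbb{R}^d$, and let $x_1,x_2,\ldots$ be the iterates of the random-subspace walk for $\ell$ with $T$ samples per round. Then for all $n\in\mathbb{N}$, the $n$-th round of the iteration returns, with probability at least $$\left(1-(1-\delta_{\alpha'}^2)^T\right)\left(1-(1-\Theta_{\ell_{\alpha'}}^2/2)^T\right)^n,$$ a point $x_{n+1}\in\mathbb{R}^d$ satisfying $$\ell(x_{n+1})-\alpha'\ \le\ (1-\delta_{\alpha'})\,(1-2^{-1/2}\Theta_{\ell_{\alpha'}})^n\,(\alpha_{\max}-\alpha').$$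
   Context: $\mathcal G_{k,d}$ is the Grassmannian of $k$-dimensional linear subspaces ("$k$-planes") of $\mathbb{R}^d$, with its unique $O(d)$-invariant probability measure. For $x\in\mathbb{R}^d$, $\mathcal G_{k,d,x}=\{\eta\in\mathcal G_{k,d}: x\in\eta\}$; for $x\ne0$ it carries the unique probability measure invariant under the stabilizer of $x$ in $O(d)$, and $\mathcal G_{k,d,0}=\mathcal G_{k,d}$. "Uniformly at random" refers to these measures; means and $L^2$-norms on these spaces are also taken with respect to these measures. The function $\ell$ is coercive ($\ell(x)\to\infty$ as $\|x\|\to\infty$), so it attains a minimum on each $k$-plane. Define $\phi(\eta)=\min_{y\in\eta}\ell(y)$ for $\eta\in\mathcal G_{k,d}$, and let $\alpha_{\max}$ be the maximum value of $\phi$ on $\mathcal G_{k,d}$. Gap parameter: for a continuous coercive $L:\mathbb{R}^d\to\mathbb{R}$, put $\phi_L(\eta)=\min_{y\in\eta}L(y)$ and $$\Theta_L=\inf_x \frac{\left\|\phi_L|_{\mathcal G_{k,d,x}}-\overline{\phi_L|_{\mathcal G_{k,d,x}}}\right\|_{2,\mathcal G_{k,d,x}}}{\max(\phi_L|_{\mathcal G_{k,d,x}})-\min(\phi_L|_{\mathcal G_{k,d,x}})},$$ where the infimum is over all $x\in\mathbb{R}^d$ for which $\phi_L|_{\mathcal G_{k,d,x}}$ is nonconstant, the bar denotes the mean over $\mathcal G_{k,d,x}$, and $\|\cdot\|_{2,\mathcal G_{k,d,x}}$ is the $L^2$-norm over $\mathcal G_{k,d,x}$. Random-subspace walk for $\ell$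 (run without a stopping rule): one has a black box $\mathcal B$ which, for each $k$-plane $\eta$, returns a point $\mathcal B(\eta)\in\eta$ with $\ell(\mathcal B(\eta))=\phi(\eta)$. Start with a fixed $x_0\in\mathbb{R}^d$. Sample $\eta^{(1)},\ldots,\eta^{(T)}$ independently and uniformly from $\mathcal G_{k,d}$ and let $x_1$ be any element of $\{\mathcal B(\eta^{(1)}),\ldots,\mathcal B(\eta^{(T)})\}$ at which $\ell$ is smallest. For $i\ge1$, given the past, sample fresh $\eta^{(1)},\ldots,\eta^{(T)}$ independently and uniformly from $\mathcal G_{k,d,x_i}$ and let $x_{i+1}$ be any element of $\{\mathcal B(\eta^{(1)}),\ldots,\mathcal B(\eta^{(T)})\}$ at which $\ell$ is smallest (the "$i$-th round"). The black box and tie-breaking are understood to be such that the iterates are random variables. *)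

theory Defs
  imports "HOL-Probability.Probability"
begin

text \<open>
  Minimum and maximum of a set of reals in the literal sense (least/greatest element, not
  infimum/supremum). They are only used where the extremum is attained.
\<close>

definition minimum :: "real set \<Rightarrow> real" where
  "minimum S = (LEAST m. m \<in> S)"

definition maximum :: "real set \<Rightarrow> real" where
  "maximum S = (GREATEST m. m \<in> S)"

definition coercive :: "(real ^ 'd \<Rightarrow> real) \<Rightarrow> bool" where
  "coercive L \<longleftrightarrow> filterlim L at_top at_infinity"

definition grassmannian :: "nat \<Rightarrow> (real ^ 'd) set set" where
  "grassmannian k = {\<eta>. subspace \<eta> \<and> dim \<eta> = k}"

definition grassmannian_at :: "nat \<Rightarrow> real ^ 'd \<Rightarrow> (real ^ 'd) set set" where
  "grassmannian_at k x = {\<eta> \<in> grassmannian k. x \<in> \<eta>}"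

text \<open>
  The Borel sigma-algebra of the usual topology, obtained by identifying a plane
  with the matrix of the orthogonal projection onto it (nearest-point map).
\<close>

definition grassmannian_borel :: "nat \<Rightarrow> real ^ 'd \<Rightarrow> (real ^ 'd) set measure" where
  "grassmannian_borel k x =
     vimage_algebra (grassmannian_at k x) (\<lambda>\<eta>. matrix (closest_point \<eta>)) borel"

text \<open>
  \<open>N\<close> is the probability measure on the planes through \<open>x\<close> that is invariant under the
  stabilizer of \<open>x\<close> in the orthogonal group. Since that group is compact and acts transitively,
  exactly one \<open>N\<close> has this property when \<open>1 \<le> k\<close> and \<open>k \<le> CARD('d)\<close>. For \<open>x = 0\<close> the
  stabilizer is the whole orthogonal group and the planes through \<open>x\<close> form the whole Grassmannian.
\<close>

definition uniform_planes :: "nat \<Rightarrow> real ^ 'd \<Rightarrow> (real ^ 'd) set measure \<Rightarrow> bool" where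
  "uniform_planes k x N \<longleftrightarrow>
     prob_space N \<and>
     space N = grassmannian_at k x \<and>
     sets N = sets (grassmannian_borel k x) \<and>
     (\<forall>f. orthogonal_transformation f \<and> f x = x \<longrightarrow> distr N N (\<lambda>\<eta>. f ` \<eta>) = N)"

definition phi :: "(real ^ 'd \<Rightarrow> real) \<Rightarrow> (real ^ 'd) set \<Rightarrow> real" where
  "phi L \<eta> = minimum (L ` \<eta>)"

definition alpha_max :: "nat \<Rightarrow> (real ^ 'd \<Rightarrow> real) \<Rightarrow> real" where
  "alpha_max k L = maximum (phi L ` grassmannian k)"

definition L2_deviation :: "'b measure \<Rightarrow> ('b \<Rightarrow> real) \<Rightarrow> real" where
  "L2_deviation N f = sqrt (\<integral>\<eta>. (f \<eta> - (\<integral>\<xi>. f \<xi> \<partial>N))\<^sup>2 \<partial>N)"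

text \<open>
  Below, \<open>\<mu> x\<close> stands for the invariant probability measure on \<open>grassmannian_at k x\<close>.
\<close>

definition gap_parameter ::
    "(real ^ 'd \<Rightarrow> (real ^ 'd) set measure) \<Rightarrow> nat \<Rightarrow> (real ^ 'd \<Rightarrow> real) \<Rightarrow> real" where
  "gap_parameter \<mu> k L =
     (INF x \<in> {x. \<not> phi L constant_on grassmannian_at k x}.
        L2_deviation (\<mu> x) (phi L) /
        (maximum (phi L ` grassmannian_at k x) - minimum (phi L ` grassmannian_at k x)))"

definition truncated :: "(real ^ 'd \<Rightarrow> real) \<Rightarrow> real \<Rightarrow> real ^ 'd \<Rightarrow> real" where
  "truncated L \<alpha> x = max (L x) \<alpha>"

definition delta ::
    "(real ^ 'd \<Rightarrow> (real ^ 'd) set measure) \<Rightarrow> nat \<Rightarrow> (real ^ 'd \<Rightarrow> real) \<Rightarrow> real \<Rightarrow> real" where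
  "delta \<mu> k L \<alpha> =
     1 / sqrt 2 * (L2_deviation (\<mu> 0) (phi (truncated L \<alpha>)) / (alpha_max k L - \<alpha>))"

definition black_box :: "nat \<Rightarrow> (real ^ 'd \<Rightarrow> real) \<Rightarrow> ((real ^ 'd) set \<Rightarrow> real ^ 'd) \<Rightarrow> bool" where
  "black_box k L B \<longleftrightarrow> (\<forall>\<eta> \<in> grassmannian k. B \<eta> \<in> \<eta> \<and> L (B \<eta>) = phi L \<eta>)"

text \<open>
  \<open>X i\<close> is the \<open>i\<close>-th iterate and \<open>H i t\<close> (\<open>t < T\<close>) are the planes sampled in
  round \<open>i\<close>, from which \<open>X (Suc i)\<close> is computed. The past of round \<open>i\<close> is the sigma-algebra
  generated by the iterates up to \<open>X i\<close> and by the planes of all earlier rounds.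
\<close>

definition walk_past ::
    "'w measure \<Rightarrow> nat \<Rightarrow> nat \<Rightarrow> (nat \<Rightarrow> nat \<Rightarrow> 'w \<Rightarrow> (real ^ 'd) set) \<Rightarrow>
     (nat \<Rightarrow> 'w \<Rightarrow> real ^ 'd) \<Rightarrow> nat \<Rightarrow> 'w measure" where
  "walk_past M k T H X i = sigma (space M)
     ({X j -` A \<inter> space M | j A. j \<le> i \<and> A \<in> sets borel} \<union>
      {H j t -` A \<inter> space M | j t A. j < i \<and> t < T \<and> A \<in> sets (grassmannian_borel k 0)})"

text \<open>
  The sampling in rounds \<open>i \<ge> 1\<close> is expressed by the joint conditional law of the \<open>T\<close> planes
  given the past: it is the \<open>T\<close>-fold product of \<open>\<mu> (X i)\<close>, as tested on measurable rectangles.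
  (The planes are random elements of the whole Grassmannian; that almost surely they contain
  \<open>X i\<close> is part of this condition, because \<open>\<mu> (X i)\<close> lives on the planes through \<open>X i\<close>.)
  Ties among the best black-box answers may be broken in any way, possibly at random.
\<close>

definition random_subspace_walk ::
    "'w measure \<Rightarrow> (real ^ 'd \<Rightarrow> (real ^ 'd) set measure) \<Rightarrow> nat \<Rightarrow> nat \<Rightarrow>
     (real ^ 'd \<Rightarrow> real) \<Rightarrow> ((real ^ 'd) set \<Rightarrow> real ^ 'd) \<Rightarrow> real ^ 'd \<Rightarrow>
     (nat \<Rightarrow> nat \<Rightarrow> 'w \<Rightarrow> (real ^ 'd) set) \<Rightarrow> (nat \<Rightarrow> 'w \<Rightarrow> real ^ 'd) \<Rightarrow> bool" where
  "random_subspace_walk M \<mu> k T L B x0 H X \<longleftrightarrow>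
     prob_space M \<and>
     (\<forall>i. X i \<in> borel_measurable M) \<and>
     (\<forall>i. \<forall>t<T. H i t \<in> measurable M (grassmannian_borel k 0)) \<and>
     (\<forall>\<omega>\<in>space M. X 0 \<omega> = x0) \<and>
     (\<forall>i. \<forall>\<omega>\<in>space M. X (Suc i) \<omega> \<in> (\<lambda>t. B (H i t \<omega>)) ` {..<T} \<and>
        (\<forall>t<T. L (X (Suc i) \<omega>) \<le> L (B (H i t \<omega>)))) \<and>
     prob_space.indep_vars M (\<lambda>_. grassmannian_borel k 0) (H 0) {..<T} \<and>
     (\<forall>t<T. distr M (grassmannian_borel k 0) (H 0 t) = \<mu> 0) \<and>
     (\<forall>i\<ge>1. \<forall>A. (\<forall>t<T. A t \<in> sets (grassmannian_borel k 0)) \<longrightarrow>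
        (AE \<omega> in M.
           real_cond_exp M (walk_past M k T H X i)
             (indicator {\<omega> \<in> space M. \<forall>t<T. H i t \<omega> \<in> A t}) \<omega> =
           (\<Prod>t<T. measure (\<mu> (X i \<omega>)) (A t \<inter> grassmannian_at k (X i \<omega>)))))"

end

theory Submission
  imports Defs
begin

text \<open>
  Write \<open>g = max \<l> \<alpha>'\<close>. Three observations drive the proof.

  The planes through a point \<open>x\<close> have a known best value. As \<open>k > 1\<close>, some \<open>k\<close>-plane contains both
  \<open>x\<close> and a global minimiser of \<open>\<l>\<close>, so the minimum of \<open>phi g\<close> over the planes through \<open>x\<close> is
  exactly \<open>\<alpha>'\<close> (\<open>minimum_phi_g\<close>). Its maximum is at most \<open>g x\<close>, because \<open>x\<close> itself
  competes in every such plane.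

  A large deviation forces a good chance of progress. Let \<open>Z\<close> be a random variable with values in
  \<open>[0, 1]\<close> and variance at least \<open>2 r\<^sup>2\<close>. Then \<open>2 r\<^sup>2 \<le> E Z\<^sup>2 \<le> r\<^sup>2 + P (Z \<ge> r)\<close>, so
  \<open>Z \<ge> r\<close> with probability at least \<open>r\<^sup>2\<close>
  (\<open>prob_near_upper_bound_le\<close>). Apply this to the relative improvement
  \<open>Z = (b - phi g \<eta>) / (b - \<alpha>')\<close> of a random plane \<open>\<eta>\<close>. In the first round \<open>b\<close> is
  \<open>alpha_max\<close> and \<open>r\<close> is \<open>delta\<close>; in later rounds \<open>b\<close> is the worst value through the current
  point and \<open>r\<close> is the gap parameter divided by \<open>sqrt 2\<close>.

  The rounds chain through deterministic thresholds \<open>c\<^sub>n\<close>. If \<open>g - \<alpha>' \<le> c\<^sub>n\<close> at the current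
  point, each sampled plane misses \<open>c\<^sub>n\<^sub>+\<^sub>1 = (1 - r) c\<^sub>n\<close> with conditional probability at
  most \<open>1 - r\<^sup>2\<close> (\<open>prob_poor_plane_le\<close>), so all \<open>T\<close> of them miss it with probability at most
  \<open>(1 - r\<^sup>2) ^ T\<close>. Because the set of planes that miss the threshold does not depend on the current
  point, the conditional law on a single measurable rectangle suffices (\<open>prob_walk_round_le\<close>),
  and induction on the round gives the product of probabilities.

  All minima and maxima involved have to be attained. On a plane this is coercivity; over the planes
  through \<open>x\<close> it is upper semicontinuity of \<open>phi\<close> together with compactness
  (\<open>phi_attains_maximum\<close>).
\<close>

section \<open>Minima of a coercive function on planes\<close>

lemma minimum_eqI: "m \<in> S \<Longrightarrow> (\<And>s. s \<in> S \<Longrightarrow> m \<le> s) \<Longrightarrow> minimum S = m"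
  unfolding minimum_def by (rule Least_equality)

lemma maximum_eqI: "m \<in> S \<Longrightarrow> (\<And>s. s \<in> S \<Longrightarrow> s \<le> m) \<Longrightarrow> maximum S = m"
  unfolding maximum_def by (rule Greatest_equality)

lemma coercive_attains_minimum:
  assumes L: "continuous_on UNIV L" "coercive L" and S: "closed S" "S \<noteq> {}"
  obtains y where "y \<in> S" "\<And>z. z \<in> S \<Longrightarrow> L y \<le> L z"
proof -
  obtain s where s: "s \<in> S" using S by auto
  have "eventually (\<lambda>x. L s \<le> L x) at_infinity"
    using L(2) unfolding coercive_def filterlim_at_top by blast
  then obtain b where b: "\<And>x. b \<le> norm x \<Longrightarrow> L s \<le> L x"
    unfolding eventually_at_infinity by blast
  let ?K = "S \<inter> cball 0 (max b (norm s))"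
  have "compact ?K" using S by (simp add: closed_Int_compact)
  moreover have "s \<in> ?K" using s by auto
  moreover have "continuous_on ?K L" using L(1) continuous_on_subset by blast
  ultimately obtain y where y: "y \<in> ?K" "\<And>z. z \<in> ?K \<Longrightarrow> L y \<le> L z"
    using continuous_attains_inf[of ?K L] by blast
  have "L y \<le> L z" if "z \<in> S" for z
    using y(2)[of z] y(2)[OF \<open>s \<in> ?K\<close>] b[of z] that by fastforce
  with y(1) that show ?thesis by blast
qed

lemma phi_attained:
  assumes "continuous_on UNIV L" "coercive L" and "closed S" "S \<noteq> {}"
  shows "\<exists>y\<in>S. L y = phi L S" and "\<And>z. z \<in> S \<Longrightarrow> phi L S \<le> L z"
proof -
  obtain y where y: "y \<in> S" "\<And>z. z \<in> S \<Longrightarrow> L y \<le> L z"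
    using coercive_attains_minimum[OF assms] by blast
  then have "phi L S = L y" unfolding phi_def by (intro minimum_eqI) auto
  with y show "\<exists>y\<in>S. L y = phi L S" "\<And>z. z \<in> S \<Longrightarrow> phi L S \<le> L z" by auto
qed

text \<open>
  Strict sublevel sets of \<open>phi L\<close> are unions, over points \<open>y\<close>, of open conditions on the plane. This
  gives upper semicontinuity and measurability of \<open>phi L\<close> at once.
\<close>

lemma phi_less_iff:
  assumes "continuous_on UNIV L" "coercive L" and "closed S" "S \<noteq> {}"
  shows "phi L S < c \<longleftrightarrow> (\<exists>y\<in>S. L y < c)"
  using phi_attained[OF assms] by (metis le_less_trans)

lemma truncated_continuous: "continuous_on UNIV L \<Longrightarrow> continuous_on UNIV (truncated L a)"
  unfolding truncated_def by (intro continuous_intros)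

lemma truncated_coercive: "coercive L \<Longrightarrow> coercive (truncated L a)"
  unfolding coercive_def truncated_def
  by (erule filterlim_at_top_mono) simp

lemma phi_truncated:
  assumes "continuous_on UNIV L" "coercive L" and "closed S" "S \<noteq> {}"
  shows "phi (truncated L a) S = max (phi L S) a"
proof -
  obtain y where y: "y \<in> S" "L y = phi L S" using phi_attained(1)[OF assms] by blast
  show ?thesis
    unfolding phi_def[of "truncated L a"]
  proof (rule minimum_eqI)
    show "max (phi L S) a \<in> truncated L a ` S"
      using y by (auto simp: truncated_def intro!: image_eqI[of _ _ y])
  qed (auto simp: truncated_def intro: phi_attained(2)[OF assms] max.coboundedI1)
qed

lemma grassmannianD:
  assumes "\<eta> \<in> grassmannian k"
  shows "subspace \<eta>" "dim \<eta> = k" "closed \<eta>" "\<eta> \<noteq> {}"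
  using assms subspace_0 by (auto simp: grassmannian_def closed_subspace)

lemma grassmannian_at_0: "grassmannian_at k 0 = grassmannian k"
  by (auto simp: grassmannian_at_def grassmannian_def subspace_0)

section \<open>Planes through prescribed points and orthogonal projections\<close>

lemma subspace_extend_to_dim:
  fixes S :: "'a::euclidean_space set"
  assumes "subspace S" "dim S \<le> k" "k \<le> DIM('a)"
  shows "\<exists>T. subspace T \<and> S \<subseteq> T \<and> dim T = k"
  using assms
proof (induction "k - dim S" arbitrary: S)
  case 0
  then have "dim S = k" by linarith
  with 0 show ?case by blast
next
  case (Suc m)
  then have "dim S < DIM('a)" by linarith
  then obtain v where v: "v \<notin> S"
    using dim_UNIV by (metis UNIV_eq_I less_irrefl)
  then have d: "dim (insert v S) = Suc (dim S)"
    using Suc.prems(1) by (metis dim_insert span_eq_iff Suc_eq_plus1)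
  obtain T where "subspace T" "span (insert v S) \<subseteq> T" "dim T = k"
    using Suc.hyps(1)[of "span (insert v S)"] Suc.hyps(2) Suc.prems(2,3) d
    by (metis Suc_diff_Suc Suc_inject Suc_leI dim_span subspace_span zero_less_Suc zero_less_diff)
  moreover have "S \<subseteq> span (insert v S)" by (auto intro: span_base)
  ultimately show ?case by blast
qed

lemma plane_through_two_points:
  fixes x y :: "real ^ 'd"
  assumes "1 < k" "k \<le> CARD('d)"
  obtains \<eta> where "\<eta> \<in> grassmannian_at k x" "y \<in> \<eta>"
proof -
  have "dim (span {x, y}) \<le> k"
    using dim_le_card'[of "{x, y}"] card_insert_le_m1[of 2 "{y}" x] assms(1) by simp
  then obtain T where "subspace T" "span {x, y} \<subseteq> T" "dim T = k"
    using subspace_extend_to_dim[of "span {x, y}" k] assms(2) by auto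
  then have "T \<in> grassmannian_at k x" "y \<in> T"
    using span_superset[of "{x, y}"] by (auto simp: grassmannian_at_def grassmannian_def)
  then show ?thesis using that by blast
qed

text \<open>
  Pythagoras: a point of a subspace whose difference from \<open>x\<close> is orthogonal to the subspace is the
  nearest one. The orthogonality condition is linear in \<open>x\<close>, and hence so is the nearest-point map;
  this is what makes its matrix, on which the sigma-algebra of planes is based, represent it.
\<close>

lemma closest_point_subspaceI:
  fixes S :: "'a::euclidean_space set"
  assumes S: "subspace S" and p: "p \<in> S" "\<And>y. y \<in> S \<Longrightarrow> orthogonal (x - p) y"
  shows "closest_point S x = p"
proof (rule sym, rule closest_point_unique)
  show "\<forall>z\<in>S. dist x p \<le> dist x z"
  proof
    fix z assume "z \<in> S"
    then have "orthogonal (x - p) (p - z)" using S p by (simp add: subspace_diff)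
    then have "(norm (x - z))\<^sup>2 = (norm (x - p))\<^sup>2 + (norm (p - z))\<^sup>2"
      using norm_add_Pythagorean[of "x - p" "p - z"] by simp
    then have "(norm (x - p))\<^sup>2 \<le> (norm (x - z))\<^sup>2" by simp
    then show "dist x p \<le> dist x z" unfolding dist_norm by (rule power2_le_imp_le) simp
  qed
qed (use S p in \<open>auto simp: subspace_imp_convex closed_subspace\<close>)

lemma closest_point_subspace:
  fixes S :: "'a::euclidean_space set"
  assumes S: "subspace S"
  shows "closest_point S x \<in> S" "y \<in> S \<Longrightarrow> orthogonal (x - closest_point S x) y"
proof -
  have "span S = S" using S by (simp add: span_eq_iff)
  then obtain p where p: "p \<in> S" "\<And>w. w \<in> S \<Longrightarrow> orthogonal (x - p) w"
    using orthogonal_subspace_decomp_exists[of S x] by (metis add_diff_cancel_left')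
  have "closest_point S x = p"
    using p by (rule closest_point_subspaceI[OF S])
  then show "closest_point S x \<in> S" "y \<in> S \<Longrightarrow> orthogonal (x - closest_point S x) y"
    using p by simp_all
qed

lemma linear_closest_point_subspace:
  fixes S :: "'a::euclidean_space set"
  assumes S: "subspace S"
  shows "linear (closest_point S)"
proof (rule linearI)
  note cp = closest_point_subspace[OF S]
  show "closest_point S (x + y) = closest_point S x + closest_point S y" for x y
  proof (rule closest_point_subspaceI[OF S])
    show "orthogonal (x + y - (closest_point S x + closest_point S y)) w" if "w \<in> S" for w
      using cp(2)[of w x] cp(2)[of w y] that
      by (simp add: orthogonal_def inner_diff_left inner_add_left)
  qed (simp add: S cp subspace_add)
  show "closest_point S (r *\<^sub>R x) = r *\<^sub>R closest_point S x" for r x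
  proof (rule closest_point_subspaceI[OF S])
    show "orthogonal (r *\<^sub>R x - r *\<^sub>R closest_point S x) w" if "w \<in> S" for w
      using cp(2)[of w x] that
      by (simp add: orthogonal_def flip: scaleR_diff_right)
  qed (simp add: S cp subspace_scale)
qed

lemma norm_closest_point_subspace_le:
  fixes S :: "'a::euclidean_space set"
  assumes S: "subspace S"
  shows "norm (closest_point S x) \<le> norm x"
proof -
  have "closest_point S 0 = 0" using S by (simp add: linear_closest_point_subspace linear_0)
  then show ?thesis
    using closest_point_lipschitz[of S x 0] S
    by (metis closed_subspace dist_0_norm dist_commute empty_iff subspace_0 subspace_imp_convex)
qed

section \<open>The worst plane through a point\<close>

text \<open>
  If no maximum were attained, the open strict sublevel sets at the values of \<open>f\<close> would cover \<open>K\<close>;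
  the largest value that indexes a finite subcover cannot lie below any of the others.
\<close>

lemma usc_attains_maximum:
  fixes f :: "'a::topological_space \<Rightarrow> 'b::linorder"
  assumes K: "compact K" "K \<noteq> {}"
    and U: "\<And>c. open (U c)" "\<And>c p. p \<in> K \<Longrightarrow> p \<in> U c \<longleftrightarrow> f p < c"
  shows "\<exists>p\<in>K. \<forall>q\<in>K. f q \<le> f p"
proof (rule ccontr)
  assume "\<not> ?thesis"
  then have "K \<subseteq> (\<Union>q\<in>K. U (f q))" using U(2) by (force simp: not_le)
  then obtain C where C: "C \<subseteq> K" "finite C" "K \<subseteq> (\<Union>q\<in>C. U (f q))"
    using compactE_image[OF K(1), of K "\<lambda>q. U (f q)"] U(1) by blast
  then have "C \<noteq> {}" using K(2) by auto
  with C(2) have "Max (f ` C) \<in> f ` C" by simp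
  then obtain q where q: "q \<in> C" "f q = Max (f ` C)" by auto
  then obtain r where "r \<in> C" "q \<in> U (f r)" using C by blast
  then have "f q < f r" using U(2) q(1) C(1) by blast
  moreover have "f r \<le> f q" using C(2) q(2) \<open>r \<in> C\<close> by simp
  ultimately show False by simp
qed

text \<open>
  Instead of a topology on planes, the proof uses a compact parameter space. Fix a \<open>k\<close>-plane \<open>E\<close>.
  A parameter is a contraction \<open>A\<close> that is isometric on \<open>E\<close>, together with a point of \<open>E\<close> that \<open>A\<close>
  maps to \<open>x\<close>. Carrying this point along turns the condition that \<open>x\<close> lies in \<open>A ` E\<close> into
  a closed one.
\<close>

lemma phi_attains_maximum:
  fixes L :: "real ^ 'd \<Rightarrow> real"
  assumes L: "continuous_on UNIV L" "coercive L" and k: "1 < k" "k \<le> CARD('d)"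
  obtains \<eta> where "\<eta> \<in> grassmannian_at k x"
    "\<And>\<xi>. \<xi> \<in> grassmannian_at k x \<Longrightarrow> phi L \<xi> \<le> phi L \<eta>"
proof -
  obtain E where E: "E \<in> grassmannian_at k x" using plane_through_two_points[OF k] by metis
  then have E_sub: "subspace E" and E_dim: "dim E = k"
    by (auto simp: grassmannian_at_def grassmannian_def)
  define K :: "(((real ^ 'd) \<Rightarrow>\<^sub>L (real ^ 'd)) \<times> (real ^ 'd)) set" where
    "K = {p. norm (fst p) \<le> 1 \<and> (\<forall>z\<in>E. norm (blinfun_apply (fst p) z) = norm z) \<and>
             snd p \<in> E \<and> blinfun_apply (fst p) (snd p) = x}"
  have "K = {p. norm (fst p) \<le> 1} \<inter> (\<Inter>z\<in>E. {p. norm (blinfun_apply (fst p) z) = norm z})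
      \<inter> (snd -` E) \<inter> {p. blinfun_apply (fst p) (snd p) = x}"
    unfolding K_def by auto
  moreover have "closed \<dots>"
    by (intro closed_Int closed_INT ballI closed_Collect_le closed_Collect_eq
          closed_vimage_snd closed_subspace E_sub continuous_intros)
  ultimately have "closed K" by simp
  moreover have "bounded K"
  proof (rule bounded_subset)
    show "K \<subseteq> cball 0 1 \<times> cball 0 (norm x)" unfolding K_def by auto
    show "bounded (cball (0 :: (real ^ 'd) \<Rightarrow>\<^sub>L (real ^ 'd)) 1 \<times> cball (0 :: real ^ 'd) (norm x))"
      by (simp add: bounded_Times)
  qed
  ultimately have "compact K" by (simp add: compact_eq_bounded_closed)
  have image_mem: "blinfun_apply (fst p) ` E \<in> grassmannian_at k x" if "p \<in> K" for p
  proof -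
    have lin: "linear (blinfun_apply (fst p))"
      by (simp add: blinfun.bounded_linear_right bounded_linear.linear)
    have "inj_on (blinfun_apply (fst p)) (span E)"
    proof (rule inj_onI)
      fix u v assume "u \<in> span E" "v \<in> span E" "blinfun_apply (fst p) u = blinfun_apply (fst p) v"
      then have "u - v \<in> E" "blinfun_apply (fst p) (u - v) = 0"
        using E_sub by (metis span_eq_iff subspace_diff, simp add: blinfun.diff_right)
      then have "norm (u - v) = 0" using \<open>p \<in> K\<close> unfolding K_def by force
      then show "u = v" by simp
    qed
    then have "dim (blinfun_apply (fst p) ` E) = k"
      using E_dim dim_image_eq[OF lin] by simp
    then show ?thesis
      using that E_sub linear_subspace_image[OF lin]
      by (force simp: grassmannian_at_def grassmannian_def K_def)
  qed
  have image_surj: "\<exists>p\<in>K. \<eta> = blinfun_apply (fst p) ` E" if \<eta>: "\<eta> \<in> grassmannian_at k x" for \<eta>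
  proof -
    have "subspace \<eta>" "dim \<eta> = k" "x \<in> \<eta>"
      using \<eta> by (auto simp: grassmannian_at_def grassmannian_def)
    obtain f where f: "linear f" "f ` E = \<eta>" "\<And>z. z \<in> E \<Longrightarrow> norm (f z) = norm z"
      using isometries_subspaces[OF E_sub \<open>subspace \<eta>\<close>] E_dim \<open>dim \<eta> = k\<close> by metis
    obtain y where y: "y \<in> E" "f y = x" using f(2) \<open>x \<in> \<eta>\<close> by blast
    \<comment> \<open>The isometry is controlled on \<open>E\<close> only; projecting onto \<open>E\<close> first gives operator norm at
        most 1.\<close>
    define A where "A = Blinfun (f \<circ> closest_point E)"
    have "bounded_linear (f \<circ> closest_point E)"
      by (simp add: linear_compose f(1) linear_closest_point_subspace E_sub linear_linear)
    then have A: "blinfun_apply A = f \<circ> closest_point E"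
      unfolding A_def by (rule bounded_linear_Blinfun_apply)
    have on_E: "blinfun_apply A z = f z" if "z \<in> E" for z
      using that by (simp add: A closest_point_self)
    have "norm A \<le> 1"
      by (rule norm_blinfun_bound)
         (simp_all add: A f(3) closest_point_subspace(1)[OF E_sub]
           norm_closest_point_subspace_le[OF E_sub])
    then have "(A, y) \<in> K" using y on_E f(3) by (simp add: K_def)
    moreover have "blinfun_apply A ` E = \<eta>" using on_E f(2) by auto
    ultimately show ?thesis by force
  qed
  define U where "U c = (\<Union>y\<in>E. {p :: ((real ^ 'd) \<Rightarrow>\<^sub>L (real ^ 'd)) \<times> (real ^ 'd).
    L (blinfun_apply (fst p) y) < c})" for c
  have "\<exists>p\<in>K. \<forall>q\<in>K. phi L (blinfun_apply (fst q) ` E) \<le> phi L (blinfun_apply (fst p) ` E)"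
  proof (rule usc_attains_maximum[OF \<open>compact K\<close>])
    show "K \<noteq> {}" using image_surj[OF E] by auto
    show "open (U c)" for c
      unfolding U_def
      by (intro open_UN ballI open_Collect_less continuous_on_compose2[OF L(1)] continuous_intros)
        auto
    show "p \<in> U c \<longleftrightarrow> phi L (blinfun_apply (fst p) ` E) < c" if "p \<in> K" for c p
    proof -
      have "blinfun_apply (fst p) ` E \<in> grassmannian k"
        using image_mem[OF that] by (simp add: grassmannian_at_def)
      from grassmannianD(3,4)[OF this] show ?thesis
        unfolding U_def by (subst phi_less_iff[OF L]) auto
    qed
  qed
  then obtain p where p: "p \<in> K"
      "\<And>q. q \<in> K \<Longrightarrow> phi L (blinfun_apply (fst q) ` E) \<le> phi L (blinfun_apply (fst p) ` E)"
    by blast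
  show ?thesis
  proof (rule that[OF image_mem[OF p(1)]])
    fix \<xi> assume "\<xi> \<in> grassmannian_at k x"
    then obtain q where "q \<in> K" "\<xi> = blinfun_apply (fst q) ` E" using image_surj by blast
    then show "phi L \<xi> \<le> phi L (blinfun_apply (fst p) ` E)" using p(2) by simp
  qed
qed

lemma phi_measurable:
  fixes L :: "real ^ 'd \<Rightarrow> real"
  assumes L: "continuous_on UNIV L" "coercive L"
  shows "phi L \<in> borel_measurable (grassmannian_borel k x)"
  unfolding borel_measurable_iff_less
proof
  fix c
  define U where "U = (\<Union>y. {A :: real ^ 'd ^ 'd. L (A *v y) < c})"
  have "open U"
    unfolding U_def matrix_vector_mult_def
    by (intro open_UN ballI open_Collect_less continuous_on_compose2[OF L(1)]
          continuous_on_vec_lambda continuous_intros) auto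
  have sp: "space (grassmannian_borel k x) = grassmannian_at k x"
    by (simp add: grassmannian_borel_def)
  have "phi L \<eta> < c \<longleftrightarrow> matrix (closest_point \<eta>) \<in> U" if "\<eta> \<in> grassmannian_at k x" for \<eta>
  proof -
    have \<eta>: "\<eta> \<in> grassmannian k" using that by (simp add: grassmannian_at_def)
    have "matrix (closest_point \<eta>) *v y = closest_point \<eta> y" for y
      using linear_closest_point_subspace[OF grassmannianD(1)[OF \<eta>]] by (simp add: matrix_works)
    moreover have "(\<exists>y\<in>\<eta>. L y < c) \<longleftrightarrow> (\<exists>y. L (closest_point \<eta> y) < c)"
      by (metis closest_point_self closest_point_subspace(1) grassmannianD(1)[OF \<eta>])
    ultimately show ?thesis
      by (simp add: U_def phi_less_iff[OF L grassmannianD(3,4)[OF \<eta>]])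
  qed
  then have "{\<eta> \<in> space (grassmannian_borel k x). phi L \<eta> < c} =
      (\<lambda>\<eta>. matrix (closest_point \<eta>)) -` U \<inter> grassmannian_at k x"
    unfolding sp by auto
  also have "\<dots> \<in> sets (grassmannian_borel k x)"
    unfolding grassmannian_borel_def using \<open>open U\<close> by (intro in_vimage_algebra) auto
  finally show "{\<eta> \<in> space (grassmannian_borel k x). phi L \<eta> < c} \<in> sets (grassmannian_borel k x)" .
qed

section \<open>Two probabilistic estimates\<close>

lemma (in prob_space) integrable_indicator_event:
  "A \<in> events \<Longrightarrow> integrable M (indicator A :: 'a \<Rightarrow> real)"
  by (intro integrable_const_bound[of _ 1]) auto

text \<open>
  The second moment of \<open>b - f\<close> is at least the variance of \<open>f\<close>, hence at least
  \<open>2 * r\<^sup>2 * (b - a)\<^sup>2\<close>. Where \<open>f\<close> is within \<open>r * (b - a)\<close> of \<open>b\<close> it contributes at most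
  \<open>r\<^sup>2 * (b - a)\<^sup>2\<close>; elsewhere \<open>(b - f)\<^sup>2\<close> is at most \<open>(b - a)\<^sup>2\<close>, so the remaining half has to come
  from an event of probability at least \<open>r\<^sup>2\<close>.
\<close>

lemma (in prob_space) prob_near_upper_bound_le:
  assumes f: "f \<in> borel_measurable M" "\<And>\<omega>. \<omega> \<in> space M \<Longrightarrow> a \<le> f \<omega>"
      "\<And>\<omega>. \<omega> \<in> space M \<Longrightarrow> f \<omega> \<le> b"
    and "a < b" "0 \<le> r" and r: "sqrt 2 * r * (b - a) \<le> L2_deviation M f"
  shows "prob {\<omega> \<in> space M. b - r * (b - a) < f \<omega>} \<le> 1 - r\<^sup>2"
proof -
  define A where "A = {\<omega> \<in> space M. b - r * (b - a) < f \<omega>}"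
  have [measurable]: "f \<in> borel_measurable M" by fact
  have A [measurable]: "A \<in> sets M" unfolding A_def by measurable
  have bd: "\<bar>f \<omega>\<bar> \<le> \<bar>a\<bar> + \<bar>b\<bar>" if "\<omega> \<in> space M" for \<omega>
    using f(2,3)[OF that] by linarith
  have int_f: "integrable M f"
    using bd by (intro integrable_const_bound[of _ "\<bar>a\<bar> + \<bar>b\<bar>"]) auto
  have int_f2: "integrable M (\<lambda>\<omega>. (f \<omega>)\<^sup>2)"
    using bd power_mono[OF bd, of _ 2]
    by (intro integrable_const_bound[of _ "(\<bar>a\<bar> + \<bar>b\<bar>)\<^sup>2"]) auto
  have sq: "expectation (\<lambda>\<omega>. (b - f \<omega>)\<^sup>2) = variance f + (b - expectation f)\<^sup>2"
    using int_f int_f2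
    by (simp add: variance_eq power2_diff prob_space algebra_simps power2_eq_square)
  have "2 * r\<^sup>2 * (b - a)\<^sup>2 = (sqrt 2 * r * (b - a))\<^sup>2"
    by (simp add: power_mult_distrib)
  also have "\<dots> \<le> (L2_deviation M f)\<^sup>2"
    using r \<open>a < b\<close> \<open>0 \<le> r\<close> by (intro power_mono) auto
  also have "\<dots> = variance f"
    unfolding L2_deviation_def by simp
  also have "\<dots> \<le> expectation (\<lambda>\<omega>. (b - f \<omega>)\<^sup>2)" using sq by simp
  also have "\<dots> \<le> expectation (\<lambda>\<omega>. r\<^sup>2 * (b - a)\<^sup>2 + (b - a)\<^sup>2 * indicator (space M - A) \<omega>)"
  proof (rule integral_mono)
    show "integrable M (\<lambda>\<omega>. (b - f \<omega>)\<^sup>2)"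
      using int_f int_f2 by (simp add: power2_diff)
    have "integrable M (indicator (space M - A) :: 'a \<Rightarrow> real)"
      by (simp add: integrable_indicator_event)
    then show "integrable M (\<lambda>\<omega>. r\<^sup>2 * (b - a)\<^sup>2 + (b - a)\<^sup>2 * indicator (space M - A) \<omega>)"
      by simp
    fix \<omega> assume \<omega>: "\<omega> \<in> space M"
    show "(b - f \<omega>)\<^sup>2 \<le> r\<^sup>2 * (b - a)\<^sup>2 + (b - a)\<^sup>2 * indicator (space M - A) \<omega>"
    proof (cases "\<omega> \<in> A")
      case True
      then have "(b - f \<omega>)\<^sup>2 \<le> (r * (b - a))\<^sup>2"
        using f(3)[OF \<omega>] by (intro power_mono) (auto simp: A_def)
      with True show ?thesis by (simp add: power_mult_distrib)
    next
      case False
      have "(b - f \<omega>)\<^sup>2 \<le> (b - a)\<^sup>2"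
        using f(2,3)[OF \<omega>] by (intro power_mono) auto
      with False \<omega> show ?thesis by (simp add: add_increasing)
    qed
  qed
  also have "\<dots> = r\<^sup>2 * (b - a)\<^sup>2 + (b - a)\<^sup>2 * (1 - prob A)"
    by (simp add: integrable_indicator_event prob_space prob_compl)
  finally have "(b - a)\<^sup>2 * (r\<^sup>2 + prob A) \<le> (b - a)\<^sup>2 * 1" by (simp add: algebra_simps)
  then have "r\<^sup>2 + prob A \<le> 1"
    using \<open>a < b\<close> by (subst (asm) mult_le_cancel_left_pos) auto
  then show ?thesis unfolding A_def by simp
qed

lemma (in prob_space) prob_Int_le_of_cond_exp_le:
  assumes F: "subalgebra M F" and E: "E \<in> sets F" and S: "S \<in> events"
    and le: "AE \<omega> in M. \<omega> \<in> E \<longrightarrow> real_cond_exp M F (indicator S) \<omega> \<le> r"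
  shows "prob (E \<inter> S) \<le> r * prob E"
proof -
  interpret F: finite_measure_subalgebra M F using F by unfold_locales
  have EM: "E \<in> events" using E F by (auto simp: subalgebra_def)
  have int_S: "integrable M (indicator S :: 'a \<Rightarrow> real)"
    using S by (rule integrable_indicator_event)
  have "prob (E \<inter> S) = (\<integral>\<omega>\<in>E. indicator S \<omega> \<partial>M)"
    using EM S by (simp add: set_lebesgue_integral_def flip: indicator_inter_arith)
  also have "\<dots> = (\<integral>\<omega>\<in>E. real_cond_exp M F (indicator S) \<omega> \<partial>M)"
    by (rule F.real_cond_exp_intA[OF int_S E])
  also have "\<dots> \<le> (\<integral>\<omega>\<in>E. r \<partial>M)"
    unfolding set_lebesgue_integral_def
  proof (rule integral_mono_AE)
    show "AE \<omega> in M. indicat_real E \<omega> *\<^sub>R real_cond_exp M F (indicator S) \<omega> \<le> indicat_real E \<omega> *\<^sub>R r"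
      using le by eventually_elim (auto simp: indicator_def)
  qed (rule integrable_mult_indicator[OF EM F.real_cond_exp_int(1)[OF int_S]]
        integrable_mult_indicator[OF EM integrable_const])+
  also have "\<dots> = r * prob E" using EM by (simp add: set_lebesgue_integral_def)
  finally show ?thesis .
qed

section \<open>One round of the walk\<close>

lemma walkD:
  assumes "random_subspace_walk M \<mu> k T L B x0 H X"
  shows "prob_space M" and "X i \<in> borel_measurable M"
    and "t < T \<Longrightarrow> H i t \<in> measurable M (grassmannian_borel k 0)"
    and "\<omega> \<in> space M \<Longrightarrow> t < T \<Longrightarrow> L (X (Suc i) \<omega>) \<le> L (B (H i t \<omega>))"
  using assms by (simp_all add: random_subspace_walk_def)

lemma walk_past_subalgebra:
  assumes "random_subspace_walk M \<mu> k T L B x0 H X"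
  shows "subalgebra M (walk_past M k T H X i)"
proof -
  have "{X j -` A \<inter> space M | j A. j \<le> i \<and> A \<in> sets borel} \<union>
      {H j t -` A \<inter> space M | j t A. j < i \<and> t < T \<and> A \<in> sets (grassmannian_borel k 0)}
      \<subseteq> sets M"
    using measurable_sets[OF walkD(2)[OF assms]] measurable_sets[OF walkD(3)[OF assms]] by blast
  then show ?thesis
    unfolding walk_past_def subalgebra_def
    by (simp add: sets.sigma_sets_subset sets.space_closed subset_trans[OF _ sets.space_closed])
qed

lemma walk_iterate_in_past:
  assumes "A \<in> sets borel"
  shows "X i -` A \<inter> space M \<in> sets (walk_past M k T H X i)"
proof -
  have "X i -` A \<inter> space M \<in> {X j -` A \<inter> space M | j A. j \<le> i \<and> A \<in> sets borel} \<union>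
      {H j t -` A \<inter> space M | j t A. j < i \<and> t < T \<and> A \<in> sets (grassmannian_borel k 0)}"
    using assms by blast
  then show ?thesis
    unfolding walk_past_def
    by (intro in_measure_of) auto
qed

lemma walk_planes_event:
  assumes W: "random_subspace_walk M \<mu> k T L B x0 H X"
    and A: "A \<in> sets (grassmannian_borel k 0)"
  shows "{\<omega> \<in> space M. \<forall>t<T. H i t \<omega> \<in> A} \<in> sets M"
proof -
  have "{\<omega> \<in> space M. H i t \<omega> \<in> A} \<in> sets M" if "t \<in> {..<T}" for t
  proof -
    have "t < T" using that by simp
    from walkD(3)[OF W this] have "H i t -` A \<inter> space M \<in> sets M"
      using A by (rule measurable_sets)
    moreover have "{\<omega> \<in> space M. H i t \<omega> \<in> A} = H i t -` A \<inter> space M" by blast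
    ultimately show ?thesis by (simp only:)
  qed
  from sets.sets_Collect_finite_All[OF this finite_lessThan]
  show ?thesis by (simp only: Ball_def lessThan_iff)
qed

lemma prob_walk_first_round:
  assumes W: "random_subspace_walk M \<mu> k T L B x0 H X" and T: "1 \<le> T"
    and A: "A \<in> sets (grassmannian_borel k 0)"
  shows "measure M {\<omega> \<in> space M. \<forall>t<T. H 0 t \<omega> \<in> A} = measure (\<mu> 0) A ^ T"
proof -
  interpret prob_space M by (rule walkD(1)[OF W])
  have H: "H 0 t \<in> measurable M (grassmannian_borel k 0)"
    "distr M (grassmannian_borel k 0) (H 0 t) = \<mu> 0" if "t < T" for t
    using W that by (auto simp: random_subspace_walk_def)
  have ne: "{..<T} \<noteq> {}" using T by (simp add: lessThan_empty_iff)
  then have "{\<omega> \<in> space M. \<forall>t<T. H 0 t \<omega> \<in> A} = (\<Inter>t<T. H 0 t -` A \<inter> space M)"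
    by auto
  also have "prob \<dots> = (\<Prod>t<T. prob (H 0 t -` A \<inter> space M))"
    using W ne A by (intro indep_varsD[where I = "{..<T}"]) (simp_all add: random_subspace_walk_def)
  also have "\<dots> = (\<Prod>t<T. measure (\<mu> 0) A)"
  proof (rule prod.cong)
    fix t assume "t \<in> {..<T}"
    then have "t < T" by simp
    from measure_distr[OF H(1)[OF this] A] show "prob (H 0 t -` A \<inter> space M) = measure (\<mu> 0) A"
      by (simp add: H(2)[OF \<open>t < T\<close>])
  qed simp
  finally show ?thesis by simp
qed

text \<open>
  The event that the current point lies in \<open>C\<close> belongs to the past, so integrating the conditional
  law of the sampled planes over it bounds the joint probability. The set \<open>A\<close> of planes is the same
  for all points of \<open>C\<close>, and the conditional law enters only through its values at these points.
\<close>

lemma prob_walk_round_le: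
  assumes W: "random_subspace_walk M \<mu> k T L B x0 H X" and i: "1 \<le> i"
    and A: "A \<in> sets (grassmannian_borel k 0)" and C: "C \<in> sets borel"
    and le: "\<And>x. x \<in> C \<Longrightarrow> measure (\<mu> x) (A \<inter> grassmannian_at k x) \<le> q"
  shows "measure M {\<omega> \<in> space M. X i \<omega> \<in> C \<and> (\<forall>t<T. H i t \<omega> \<in> A)}
    \<le> q ^ T * measure M {\<omega> \<in> space M. X i \<omega> \<in> C}"
proof -
  interpret prob_space M by (rule walkD(1)[OF W])
  define S where "S = {\<omega> \<in> space M. \<forall>t<T. H i t \<omega> \<in> A}"
  have S: "S \<in> events" unfolding S_def by (rule walk_planes_event[OF W A])
  have "\<forall>A. (\<forall>t<T. A t \<in> sets (grassmannian_borel k 0)) \<longrightarrow>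
      (AE \<omega> in M. real_cond_exp M (walk_past M k T H X i)
         (indicator {\<omega> \<in> space M. \<forall>t<T. H i t \<omega> \<in> A t}) \<omega> =
         (\<Prod>t<T. measure (\<mu> (X i \<omega>)) (A t \<inter> grassmannian_at k (X i \<omega>))))"
    by (rule mp[OF spec[OF W[unfolded random_subspace_walk_def, THEN conjunct2, THEN conjunct2,
          THEN conjunct2, THEN conjunct2, THEN conjunct2, THEN conjunct2, THEN conjunct2]] i])
  from spec[OF this, of "\<lambda>_. A"] A
  have ce: "AE \<omega> in M. real_cond_exp M (walk_past M k T H X i) (indicator S) \<omega> =
      (\<Prod>t<T. measure (\<mu> (X i \<omega>)) (A \<inter> grassmannian_at k (X i \<omega>)))"
    unfolding S_def by simp
  define D where "D = X i -` C \<inter> space M"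
  have le_D: "prob (D \<inter> S) \<le> q ^ T * prob D"
  proof (rule prob_Int_le_of_cond_exp_le[OF walk_past_subalgebra[OF W] _ S])
    show "D \<in> sets (walk_past M k T H X i)"
      unfolding D_def by (rule walk_iterate_in_past[OF C])
    show "AE \<omega> in M. \<omega> \<in> D \<longrightarrow>
        real_cond_exp M (walk_past M k T H X i) (indicator S) \<omega> \<le> q ^ T"
      using ce
    proof eventually_elim
      case (elim \<omega>)
      show ?case
      proof
        assume "\<omega> \<in> D"
        then have "X i \<omega> \<in> C" by (simp add: D_def)
        from power_mono[OF le[OF this] measure_nonneg, of T]
        show "real_cond_exp M (walk_past M k T H X i) (indicator S) \<omega> \<le> q ^ T"
          by (simp add: elim)
      qed
    qed
  qed
  have DS: "{\<omega> \<in> space M. X i \<omega> \<in> C \<and> (\<forall>t<T. H i t \<omega> \<in> A)} = D \<inter> S"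
    unfolding D_def S_def by blast
  have D: "{\<omega> \<in> space M. X i \<omega> \<in> C} = D"
    unfolding D_def by blast
  show ?thesis unfolding DS D by (rule le_D)
qed

lemma walk_next_value_le:
  fixes L :: "real ^ 'd \<Rightarrow> real"
  assumes W: "random_subspace_walk M \<mu> k T L B x0 H X" and B: "black_box k L B"
    and "\<omega> \<in> space M" "t < T"
  shows "H i t \<omega> \<in> grassmannian k" "L (X (Suc i) \<omega>) \<le> phi L (H i t \<omega>)"
proof -
  show G: "H i t \<omega> \<in> grassmannian k"
    using measurable_space[OF walkD(3)[OF W \<open>t < T\<close>] \<open>\<omega> \<in> space M\<close>, of i]
    by (simp add: grassmannian_borel_def grassmannian_at_0)
  have "L (X (Suc i) \<omega>) \<le> L (B (H i t \<omega>))"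
    by (rule walkD(4)[OF W assms(3,4)])
  also have "\<dots> = phi L (H i t \<omega>)" using B G by (simp add: black_box_def)
  finally show "L (X (Suc i) \<omega>) \<le> phi L (H i t \<omega>)" .
qed

section \<open>Progress of the truncated loss\<close>

locale truncated_loss =
  fixes k :: nat and L :: "real ^ 'd \<Rightarrow> real" and \<alpha> :: real
    and \<mu> :: "real ^ 'd \<Rightarrow> (real ^ 'd) set measure"
  assumes k: "1 < k" "k < CARD('d)"
    and L_cont: "continuous_on UNIV L" and L_coercive: "coercive L"
    and \<alpha>_ge: "minimum (range L) \<le> \<alpha>" and \<alpha>_less: "\<alpha> < alpha_max k L"
    and uniform: "\<And>x. uniform_planes k x (\<mu> x)"
begin

abbreviation g where "g \<equiv> truncated L \<alpha>"

abbreviation \<tau> where "\<tau> \<equiv> gap_parameter \<mu> k g / sqrt 2"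

lemmas g_cont = truncated_continuous[OF L_cont, of \<alpha>]
lemmas g_coercive = truncated_coercive[OF L_coercive, of \<alpha>]

lemma phi_g: "\<eta> \<in> grassmannian k \<Longrightarrow> phi g \<eta> = max (phi L \<eta>) \<alpha>"
  using phi_truncated[OF L_cont L_coercive] grassmannianD(3,4) by blast

lemma phi_g_ge: "\<eta> \<in> grassmannian k \<Longrightarrow> \<alpha> \<le> phi g \<eta>"
  by (simp add: phi_g)

lemma alpha_max_attained:
  "\<exists>\<eta>\<in>grassmannian k. phi L \<eta> = alpha_max k L"
  "\<eta> \<in> grassmannian k \<Longrightarrow> phi L \<eta> \<le> alpha_max k L"
proof -
  obtain \<xi> where "\<xi> \<in> grassmannian k" "\<And>\<eta>. \<eta> \<in> grassmannian k \<Longrightarrow> phi L \<eta> \<le> phi L \<xi>"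
    using phi_attains_maximum[OF L_cont L_coercive, of k 0] k by (auto simp: grassmannian_at_0)
  moreover from this have "alpha_max k L = phi L \<xi>"
    unfolding alpha_max_def by (intro maximum_eqI) auto
  ultimately show "\<exists>\<eta>\<in>grassmannian k. phi L \<eta> = alpha_max k L"
    "\<eta> \<in> grassmannian k \<Longrightarrow> phi L \<eta> \<le> alpha_max k L" by auto
qed

text \<open>
  This is where \<open>k > 1\<close> enters: a \<open>k\<close>-plane can contain \<open>x\<close> and a global minimiser of \<open>L\<close>.
\<close>

lemma exists_optimal_plane: "\<exists>\<eta>\<in>grassmannian_at k x. phi g \<eta> = \<alpha>"
proof -
  obtain y where y: "\<And>z. L y \<le> L z"
    using coercive_attains_minimum[OF L_cont L_coercive, of UNIV] by auto
  then have "minimum (range L) = L y" by (intro minimum_eqI) auto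
  then have "L y \<le> \<alpha>" using \<alpha>_ge by simp
  obtain \<eta> where \<eta>: "\<eta> \<in> grassmannian_at k x" "y \<in> \<eta>"
    using plane_through_two_points[of k x y] k by auto
  then have "\<eta> \<in> grassmannian k" by (simp add: grassmannian_at_def)
  then have "phi L \<eta> \<le> L y"
    using phi_attained(2)[OF L_cont L_coercive] grassmannianD(3,4) \<eta>(2) by blast
  with \<open>L y \<le> \<alpha>\<close> have "phi g \<eta> = \<alpha>" by (simp add: phi_g \<open>\<eta> \<in> grassmannian k\<close>)
  with \<eta> show ?thesis by blast
qed

lemma minimum_phi_g: "minimum (phi g ` grassmannian_at k x) = \<alpha>"
proof (rule minimum_eqI)
  show "\<alpha> \<in> phi g ` grassmannian_at k x" using exists_optimal_plane[of x] by force
qed (auto simp: grassmannian_at_def phi_g_ge)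

lemma maximum_phi_g:
  obtains \<eta> where "\<eta> \<in> grassmannian_at k x" "phi g \<eta> = maximum (phi g ` grassmannian_at k x)"
    "\<And>\<xi>. \<xi> \<in> grassmannian_at k x \<Longrightarrow> phi g \<xi> \<le> maximum (phi g ` grassmannian_at k x)"
proof -
  obtain \<eta> where \<eta>: "\<eta> \<in> grassmannian_at k x"
    "\<And>\<xi>. \<xi> \<in> grassmannian_at k x \<Longrightarrow> phi g \<xi> \<le> phi g \<eta>"
    using phi_attains_maximum[OF g_cont g_coercive, of k x] k by auto
  then have "maximum (phi g ` grassmannian_at k x) = phi g \<eta>" by (intro maximum_eqI) auto
  with \<eta> that show ?thesis by simp
qed

lemma phi_g_le_value: "\<eta> \<in> grassmannian_at k x \<Longrightarrow> phi g \<eta> \<le> g x"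
  using phi_attained(2)[OF g_cont g_coercive] grassmannianD(3,4)
  by (force simp: grassmannian_at_def)

lemma nonconstant_maximum_gt:
  assumes "\<not> phi g constant_on grassmannian_at k x"
  shows "\<alpha> < maximum (phi g ` grassmannian_at k x)"
proof (rule ccontr)
  assume "\<not> ?thesis"
  then have "phi g \<eta> = \<alpha>" if "\<eta> \<in> grassmannian_at k x" for \<eta>
    using maximum_phi_g[of x] phi_g_ge[of \<eta>] that
    by (metis (no_types, lifting) antisym grassmannian_at_def mem_Collect_eq not_le order_trans)
  with assms show False unfolding constant_on_def by blast
qed

text \<open>
  The infimum defining the gap parameter ranges over a nonempty set of points: among all planes,
  one attains \<open>alpha_max k L > \<alpha>\<close> and another attains \<open>\<alpha>\<close>.
\<close>

lemma not_constant_0: "\<not> phi g constant_on grassmannian_at k 0"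
proof -
  obtain \<eta> where \<eta>: "\<eta> \<in> grassmannian k" "phi L \<eta> = alpha_max k L" using alpha_max_attained(1) by blast
  then have "phi g \<eta> > \<alpha>" using \<alpha>_less by (simp add: phi_g)
  moreover obtain \<xi> where "\<xi> \<in> grassmannian k" "phi g \<xi> = \<alpha>"
    using exists_optimal_plane[of 0] by (auto simp: grassmannian_at_0)
  ultimately show ?thesis using \<eta> unfolding constant_on_def grassmannian_at_0 by force
qed

lemma prob_space_uniform: "prob_space (\<mu> x)"
  using uniform by (simp add: uniform_planes_def)

lemma space_uniform: "space (\<mu> x) = grassmannian_at k x"
  using uniform by (simp add: uniform_planes_def)

lemma phi_g_measurable: "phi g \<in> borel_measurable (\<mu> x)"
proof -
  have "sets (\<mu> x) = sets (grassmannian_borel k x)" using uniform by (simp add: uniform_planes_def)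
  then show ?thesis using phi_measurable[OF g_cont g_coercive] by (simp cong: measurable_cong_sets)
qed

lemma prob_phi_g_gt_le:
  assumes "\<And>\<eta>. \<eta> \<in> grassmannian_at k x \<Longrightarrow> phi g \<eta> \<le> b" "\<alpha> < b" "0 \<le> r"
    and "sqrt 2 * r * (b - \<alpha>) \<le> L2_deviation (\<mu> x) (phi g)"
  shows "measure (\<mu> x) {\<eta> \<in> grassmannian_at k x. \<alpha> + (1 - r) * (b - \<alpha>) < phi g \<eta>} \<le> 1 - r\<^sup>2"
proof -
  interpret prob_space "\<mu> x" by (rule prob_space_uniform)
  have "prob {\<eta> \<in> space (\<mu> x). b - r * (b - \<alpha>) < phi g \<eta>} \<le> 1 - r\<^sup>2"
    using assms by (intro prob_near_upper_bound_le)
      (auto simp: space_uniform grassmannian_at_def phi_g_ge phi_g_measurable)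
  then show ?thesis by (simp add: space_uniform algebra_simps)
qed

lemma gap_nonneg: "0 \<le> \<tau>"
proof -
  have "0 \<le> gap_parameter \<mu> k g"
    unfolding gap_parameter_def
  proof (rule cINF_greatest)
    show "{x. \<not> phi g constant_on grassmannian_at k x} \<noteq> {}" using not_constant_0 by blast
    fix x assume "x \<in> {x. \<not> phi g constant_on grassmannian_at k x}"
    then show "0 \<le> L2_deviation (\<mu> x) (phi g) /
        (maximum (phi g ` grassmannian_at k x) - minimum (phi g ` grassmannian_at k x))"
      using nonconstant_maximum_gt[of x]
      by (simp add: minimum_phi_g L2_deviation_def)
  qed
  then show ?thesis by simp
qed

lemma gap_le_deviation:
  assumes "\<not> phi g constant_on grassmannian_at k x"
  shows "sqrt 2 * \<tau> * (maximum (phi g ` grassmannian_at k x) - \<alpha>) \<le> L2_deviation (\<mu> x) (phi g)"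
proof -
  have "gap_parameter \<mu> k g \<le> L2_deviation (\<mu> x) (phi g) /
      (maximum (phi g ` grassmannian_at k x) - minimum (phi g ` grassmannian_at k x))"
    unfolding gap_parameter_def
  proof (rule cINF_lower)
    show "bdd_below ((\<lambda>x. L2_deviation (\<mu> x) (phi g) /
        (maximum (phi g ` grassmannian_at k x) - minimum (phi g ` grassmannian_at k x))) `
        {x. \<not> phi g constant_on grassmannian_at k x})"
      using nonconstant_maximum_gt
      by (intro bdd_belowI2[of _ 0]) (force simp: minimum_phi_g L2_deviation_def intro!: divide_nonneg_pos)
  qed (use assms in simp)
  then show ?thesis
    using nonconstant_maximum_gt[OF assms] by (simp add: minimum_phi_g field_simps)
qed

lemma prob_nearly_worst_plane_le:
  assumes "\<not> phi g constant_on grassmannian_at k x"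
  shows "measure (\<mu> x) {\<eta> \<in> grassmannian_at k x.
      \<alpha> + (1 - \<tau>) * (maximum (phi g ` grassmannian_at k x) - \<alpha>) < phi g \<eta>} \<le> 1 - \<tau>\<^sup>2"
  using maximum_phi_g[of x] nonconstant_maximum_gt[OF assms] gap_le_deviation[OF assms]
  by (intro prob_phi_g_gt_le gap_nonneg) auto

lemma gap_le_1: "\<tau> \<le> 1"
proof -
  have "0 \<le> 1 - \<tau>\<^sup>2"
    by (rule order_trans[OF measure_nonneg prob_nearly_worst_plane_le[OF not_constant_0]])
  then show ?thesis using power2_le_imp_le[of \<tau> 1] by simp
qed

text \<open>
  The deviation estimate speaks of the worst value through \<open>x\<close>, whose excess over \<open>\<alpha>\<close> is at most
  \<open>c\<close> because \<open>x\<close> lies on every such plane; the threshold can therefore be weakened to one that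
  depends on \<open>x\<close> through \<open>c\<close> only. At a point where \<open>phi g\<close> is constant, all planes are optimal.
\<close>

lemma prob_poor_plane_le:
  assumes c: "g x \<le> \<alpha> + c"
  shows "measure (\<mu> x) {\<eta> \<in> grassmannian_at k x. \<alpha> + (1 - \<tau>) * c < phi g \<eta>} \<le> 1 - \<tau>\<^sup>2"
proof (cases "phi g constant_on grassmannian_at k x")
  case True
  then have "phi g \<eta> = \<alpha>" if "\<eta> \<in> grassmannian_at k x" for \<eta>
    using exists_optimal_plane[of x] that unfolding constant_on_def by metis
  moreover have "\<alpha> \<le> g x" by (simp add: truncated_def)
  then have "0 \<le> (1 - \<tau>) * c" using gap_le_1 c by simp
  ultimately have empty: "{\<eta> \<in> grassmannian_at k x. \<alpha> + (1 - \<tau>) * c < phi g \<eta>} = {}" by force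
  have "\<tau>\<^sup>2 \<le> 1" using gap_le_1 gap_nonneg by (rule power_le_one[rotated])
  then show ?thesis unfolding empty by simp
next
  case False
  interpret prob_space "\<mu> x" by (rule prob_space_uniform)
  obtain \<eta> where "\<eta> \<in> grassmannian_at k x" "phi g \<eta> = maximum (phi g ` grassmannian_at k x)"
    using maximum_phi_g[of x] by blast
  then have "maximum (phi g ` grassmannian_at k x) - \<alpha> \<le> c"
    using phi_g_le_value c by fastforce
  then have "(1 - \<tau>) * (maximum (phi g ` grassmannian_at k x) - \<alpha>) \<le> (1 - \<tau>) * c"
    using gap_le_1 by (intro mult_left_mono) auto
  moreover note [measurable] = phi_g_measurable
  have "{\<eta> \<in> space (\<mu> x). \<alpha> + (1 - \<tau>) * (maximum (phi g ` grassmannian_at k x) - \<alpha>) < phi g \<eta>}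
      \<in> events" by measurable
  ultimately have "prob {\<eta> \<in> grassmannian_at k x. \<alpha> + (1 - \<tau>) * c < phi g \<eta>} \<le>
      prob {\<eta> \<in> grassmannian_at k x.
        \<alpha> + (1 - \<tau>) * (maximum (phi g ` grassmannian_at k x) - \<alpha>) < phi g \<eta>}"
    by (intro finite_measure_mono) (auto simp: space_uniform)
  then show ?thesis using prob_nearly_worst_plane_le[OF False] by simp
qed

lemma prob_poor_first_plane_le:
  defines "\<delta> \<equiv> delta \<mu> k L \<alpha>"
  shows "measure (\<mu> 0) {\<eta> \<in> grassmannian k. \<alpha> + (1 - \<delta>) * (alpha_max k L - \<alpha>) < phi g \<eta>} \<le> 1 - \<delta>\<^sup>2"
    and "\<delta> \<le> 1"
proof -
  have "0 \<le> \<delta>" unfolding \<delta>_def delta_def L2_deviation_def using \<alpha>_less by simp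
  have "measure (\<mu> 0) {\<eta> \<in> grassmannian_at k 0. \<alpha> + (1 - \<delta>) * (alpha_max k L - \<alpha>) < phi g \<eta>} \<le> 1 - \<delta>\<^sup>2"
  proof (rule prob_phi_g_gt_le[OF _ \<alpha>_less \<open>0 \<le> \<delta>\<close>])
    show "phi g \<eta> \<le> alpha_max k L" if "\<eta> \<in> grassmannian_at k 0" for \<eta>
      using that alpha_max_attained(2)[of \<eta>] \<alpha>_less by (simp add: grassmannian_at_0 phi_g)
    show "sqrt 2 * \<delta> * (alpha_max k L - \<alpha>) \<le> L2_deviation (\<mu> 0) (phi g)"
      using \<alpha>_less by (simp add: \<delta>_def delta_def)
  qed
  then show m: "measure (\<mu> 0) {\<eta> \<in> grassmannian k.
      \<alpha> + (1 - \<delta>) * (alpha_max k L - \<alpha>) < phi g \<eta>} \<le> 1 - \<delta>\<^sup>2"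
    by (simp add: grassmannian_at_0)
  have "0 \<le> 1 - \<delta>\<^sup>2" by (rule order_trans[OF measure_nonneg m])
  then show "\<delta> \<le> 1" using power2_le_imp_le[of \<delta> 1] by simp
qed

lemma poor_planes_measurable:
  "{\<eta> \<in> grassmannian k. c < phi g \<eta>} \<in> sets (grassmannian_borel k 0)"
proof -
  have "{\<eta> \<in> space (grassmannian_borel k 0). c < phi g \<eta>} \<in> sets (grassmannian_borel k 0)"
    using phi_measurable[OF g_cont g_coercive, of k 0] by measurable
  then show ?thesis by (simp add: grassmannian_borel_def grassmannian_at_0)
qed

lemma walk_value_le_unless_all_poor:
  assumes "random_subspace_walk M \<mu> k T L B x0 H X" "black_box k L B" "\<omega> \<in> space M"
    and "\<not> (\<forall>t<T. H i t \<omega> \<in> {\<eta> \<in> grassmannian k. c < phi g \<eta>})"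
  shows "g (X (Suc i) \<omega>) \<le> c"
proof -
  obtain t where "t < T" "H i t \<omega> \<notin> {\<eta> \<in> grassmannian k. c < phi g \<eta>}" using assms(4) by blast
  with walk_next_value_le[OF assms(1-3) \<open>t < T\<close>, of i] show ?thesis
    by (auto simp: phi_g truncated_def)
qed

end

theorem theorem4:
  fixes k T :: nat
    and \<l> :: "real ^ 'd \<Rightarrow> real"
    and \<alpha>' :: real
    and \<mu> :: "real ^ 'd \<Rightarrow> (real ^ 'd) set measure"
    and M :: "'w measure"
    and B :: "(real ^ 'd) set \<Rightarrow> real ^ 'd"
    and x0 :: "real ^ 'd"
    and H :: "nat \<Rightarrow> nat \<Rightarrow> 'w \<Rightarrow> (real ^ 'd) set"
    and X :: "nat \<Rightarrow> 'w \<Rightarrow> real ^ 'd"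
  assumes "1 < k" and "k < CARD('d)"
    and "continuous_on UNIV \<l>" and "coercive \<l>"
    and "minimum (range \<l>) \<le> \<alpha>'" and "\<alpha>' < alpha_max k \<l>"
    and "\<And>x. uniform_planes k x (\<mu> x)"
    and "T \<ge> 1"
    and "black_box k \<l> B"
    and "random_subspace_walk M \<mu> k T \<l> B x0 H X"
  shows "\<forall>n. measure M {\<omega> \<in> space M.
            \<l> (X (n + 1) \<omega>) - \<alpha>' \<le>
              (1 - delta \<mu> k \<l> \<alpha>') *
              (1 - 2 powr (- 1 / 2) * gap_parameter \<mu> k (truncated \<l> \<alpha>')) ^ n *
              (alpha_max k \<l> - \<alpha>')}
          \<ge> (1 - (1 - (delta \<mu> k \<l> \<alpha>')\<^sup>2) ^ T) *
            (1 - (1 - (gap_parameter \<mu> k (truncated \<l> \<alpha>'))\<^sup>2 / 2) ^ T) ^ n"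
    (is "\<forall>n. ?P n")
proof -
  interpret truncated_loss k \<l> \<alpha>' \<mu> using assms(1-7) by unfold_locales
  note W = assms(10)
  interpret prob_space M by (rule walkD(1)[OF W])
  define \<delta> where "\<delta> = delta \<mu> k \<l> \<alpha>'"
  define R where "R = alpha_max k \<l> - \<alpha>'"
  define c where "c n = (1 - \<delta>) * (1 - \<tau>) ^ n * R" for n
  define C where "C n = {x. g x \<le> \<alpha>' + c n}" for n
  define E where "E n = {\<omega> \<in> space M. X (Suc n) \<omega> \<in> C n}" for n
  define P where "P n = {\<eta> \<in> grassmannian k. \<alpha>' + c n < phi g \<eta>}" for n
  have \<delta>_le: "\<delta> \<le> 1" using prob_poor_first_plane_le(2) by (simp add: \<delta>_def)
  have c_nonneg: "0 \<le> c n" for n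
    using gap_le_1 \<delta>_le \<alpha>_less unfolding c_def R_def by simp
  have c_Suc: "c (Suc n) = (1 - \<tau>) * c n" for n by (simp add: c_def)
  have C: "C n \<in> sets borel" for n
    unfolding C_def using borel_measurable_continuous_onI[OF g_cont] by measurable
  have X: "X i \<in> borel_measurable M" for i by (rule walkD(2)[OF W])
  have E: "E n \<in> events" for n
    unfolding E_def using X C by measurable
  have P: "P n \<in> sets (grassmannian_borel k 0)" for n
    unfolding P_def by (rule poor_planes_measurable)
  define S where "S n = {\<omega> \<in> space M. \<forall>t<T. H n t \<omega> \<in> P n}" for n
  have S: "S n \<in> events" for n
    unfolding S_def by (rule walk_planes_event[OF W P])
  \<comment> \<open>A round misses its threshold only if all of its planes are poor.\<close>
  have E_or_S: "\<omega> \<in> E n" if "\<omega> \<in> space M" "\<omega> \<notin> S n" for \<omega> n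
    using walk_value_le_unless_all_poor[OF W assms(9) that(1), of n "\<alpha>' + c n"] that
    by (simp add: E_def C_def S_def P_def)
  have main: "(1 - (1 - \<delta>\<^sup>2) ^ T) * (1 - (1 - \<tau>\<^sup>2) ^ T) ^ n \<le> prob (E n)" for n
  proof (induction n)
    case 0
    have "prob (S 0) = measure (\<mu> 0) (P 0) ^ T"
      unfolding S_def by (rule prob_walk_first_round[OF W assms(8) P])
    also have "\<dots> \<le> (1 - \<delta>\<^sup>2) ^ T"
      using prob_poor_first_plane_le(1) by (intro power_mono) (simp_all add: P_def c_def R_def \<delta>_def)
    finally have "1 - (1 - \<delta>\<^sup>2) ^ T \<le> prob (space M - S 0)" using S by (simp add: prob_compl)
    also have "\<dots> \<le> prob (E 0)" using E E_or_S by (intro finite_measure_mono) auto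
    finally show ?case by simp
  next
    case (Suc n)
    have "prob (E n \<inter> S (Suc n)) \<le> (1 - \<tau>\<^sup>2) ^ T * prob (E n)"
    proof -
      have "measure (\<mu> x) (P (Suc n) \<inter> grassmannian_at k x) \<le> 1 - \<tau>\<^sup>2" if "x \<in> C n" for x
      proof -
        have "P (Suc n) \<inter> grassmannian_at k x =
            {\<eta> \<in> grassmannian_at k x. \<alpha>' + (1 - \<tau>) * c n < phi g \<eta>}"
          by (auto simp: P_def c_Suc grassmannian_at_def)
        with prob_poor_plane_le[of x "c n"] that show ?thesis by (simp add: C_def)
      qed
      from prob_walk_round_le[OF W _ P C this, of "Suc n"] show ?thesis
        by (simp add: E_def S_def Collect_conj_eq Int_ac)
    qed
    moreover have "prob (E n) \<le> prob (E n \<inter> S (Suc n)) + prob (E (Suc n))"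
    proof -
      have "prob (E n) \<le> prob ((E n \<inter> S (Suc n)) \<union> E (Suc n))"
        using E S E_or_S by (intro finite_measure_mono) (auto simp: E_def)
      also have "\<dots> \<le> prob (E n \<inter> S (Suc n)) + prob (E (Suc n))"
        using E S by (intro measure_Un_le) auto
      finally show ?thesis .
    qed
    ultimately have "(1 - (1 - \<tau>\<^sup>2) ^ T) * prob (E n) \<le> prob (E (Suc n))"
      by (simp add: algebra_simps)
    moreover have "\<tau>\<^sup>2 \<le> 1" using gap_le_1 gap_nonneg by (simp add: power_le_one)
    then have "0 \<le> 1 - (1 - \<tau>\<^sup>2) ^ T" by (simp add: power_le_one)
    then have "(1 - (1 - \<tau>\<^sup>2) ^ T) * ((1 - (1 - \<delta>\<^sup>2) ^ T) * (1 - (1 - \<tau>\<^sup>2) ^ T) ^ n) \<le>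
        (1 - (1 - \<tau>\<^sup>2) ^ T) * prob (E n)"
      using Suc.IH by (rule mult_left_mono[rotated])
    ultimately show ?case by (simp add: algebra_simps)
  qed
  have sqrt2: "2 powr (- 1 / 2) * gap_parameter \<mu> k g = \<tau>"
    using powr_minus_divide[of "2 :: real" "1/2"] by (simp add: powr_half_sqrt)
  have \<tau>_sq: "\<tau>\<^sup>2 = (gap_parameter \<mu> k g)\<^sup>2 / 2" by (simp add: power_divide)
  have E_eq: "E n = {\<omega> \<in> space M. \<l> (X (n + 1) \<omega>) - \<alpha>' \<le> (1 - \<delta>) * (1 - \<tau>) ^ n * R}" for n
    using c_nonneg[of n] unfolding E_def C_def c_def truncated_def by (auto simp: algebra_simps)
  show ?thesis
  proof
    fix n
    show "?P n"
      using main[of n] by (simp only: E_eq \<delta>_def R_def \<tau>_sq sqrt2)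
  qed
qed

end
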